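(* Let $A$ be a commutative, unital Banach algebra, and let $(\phi_n)_{n=1}^\infty$ be a sequence of distinct characters on $A$ such that the closure in $\Phi_A$ of $\{\phi_1,\phi_2,\dots\}$ has no perfect subsets. Suppose that $(\lambda_n)_{n=1}^\infty \in \ell_1$ is such that (with absolute operator norm convergence) \[\sum_{n=1}^\infty \lambda_n \phi_n = 0.\] Then $\lambda_n = 0$ for all $n$.
   Context: Banach algebras are over $\mathbb{C}$. A character on a commutative, unital Banach algebra $A$ is a non-zero multiplicative linear functional $A \to \mathbb{C}$. $\Phi_A$ denotes the character space of $A$, i.e. the set of all characters on $A$ with the Gelfand (relative weak-* ) topology, which is compact Hausdorff. $\ell_1$ denotes the space of absolutely summable sequences of complex numbers. The series is a series in the dual space of $A$ with the operator norm. A perfect subset of a topological space means a non-empty closed subset with no isolated points (in its relative topology). *)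

theory Defs
  imports "HOL-Analysis.Analysis"
begin

text \<open>
  Complex scalars are added to the library's real normed algebras. The norm is submultiplicative,
  but \<open>norm 1 = 1\<close> is not required. The only algebra lost through the axiom \<open>0 \<noteq> 1\<close> of
  \<^class>\<open>comm_ring_1\<close> is the zero algebra, which has no characters.
\<close>

class comm_unital_complex_banach_algebra = real_normed_algebra + comm_ring_1 + banach +
  fixes scaleC :: "complex \<Rightarrow> 'a \<Rightarrow> 'a" (infixr \<open>*\<^sub>C\<close> 75)
  assumes scaleC_add_right: "c *\<^sub>C (x + y) = c *\<^sub>C x + c *\<^sub>C y"
    and scaleC_add_left: "(c + d) *\<^sub>C x = c *\<^sub>C x + d *\<^sub>C x"
    and scaleC_scaleC: "c *\<^sub>C (d *\<^sub>C x) = (c * d) *\<^sub>C x"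
    and scaleC_of_real: "complex_of_real r *\<^sub>C x = r *\<^sub>R x"
    and mult_scaleC_left: "(c *\<^sub>C x) * y = c *\<^sub>C (x * y)"
    and norm_scaleC: "norm (c *\<^sub>C x) = cmod c * norm x"

instantiation complex :: comm_unital_complex_banach_algebra
begin

definition scaleC_complex :: "complex \<Rightarrow> complex \<Rightarrow> complex"
  where "scaleC_complex c x = c * x"

instance
  by standard (simp_all add: scaleC_complex_def algebra_simps norm_mult scaleR_conv_of_real)

end

lemma vector_space_scaleC:
  "vector_space (scaleC :: complex \<Rightarrow> 'a \<Rightarrow> 'a::comm_unital_complex_banach_algebra)"
  by unfold_locales
    (simp_all add: scaleC_add_right scaleC_add_left scaleC_scaleC scaleC_of_real[of 1, simplified])

definition is_character :: "('a::comm_unital_complex_banach_algebra \<Rightarrow> complex) \<Rightarrow> bool"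
  where "is_character \<phi> \<longleftrightarrow>
    Vector_Spaces.linear scaleC (*) \<phi> \<and> (\<forall>x y. \<phi> (x * y) = \<phi> x * \<phi> y) \<and> (\<exists>x. \<phi> x \<noteq> 0)"

text \<open>The relative weak-* topology is the topology of pointwise convergence on the algebra.\<close>

definition character_space :: "('a::comm_unital_complex_banach_algebra \<Rightarrow> complex) topology"
  where "character_space =
    subtopology (product_topology (\<lambda>_. euclidean) UNIV) (Collect is_character)"

definition perfect_subset :: "'b topology \<Rightarrow> 'b set \<Rightarrow> bool"
  where "perfect_subset X P \<longleftrightarrow>
    P \<noteq> {} \<and> closedin X P \<and> (\<forall>x\<in>P. \<not> openin (subtopology X P) {x})"

text \<open>
  Characters are automatically continuous, so a scalar multiple of a character is an element of the
  dual space. The dual norm is the norm of the type \<open>'a \<Rightarrow>\<^sub>L complex\<close> of bounded real-linear maps.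
  This type has only real scalars, so a complex scalar is applied before \<^const>\<open>Blinfun\<close>.
\<close>

lemma character_linear:
  assumes "is_character \<phi>"
  shows "\<phi> (x + y) = \<phi> x + \<phi> y" "\<phi> (c *\<^sub>C x) = c * \<phi> x"
proof -
  interpret Vector_Spaces.linear scaleC "(*)" \<phi>
    using assms by (simp add: is_character_def)
  show "\<phi> (x + y) = \<phi> x + \<phi> y" "\<phi> (c *\<^sub>C x) = c * \<phi> x"
    by (rule add, rule scale)
qed

lemma character_norm_le:
  fixes \<phi> :: "'a::comm_unital_complex_banach_algebra \<Rightarrow> complex"
  assumes "is_character \<phi>"
  shows "cmod (\<phi> x) \<le> norm x"
proof (rule ccontr)
  assume *: "\<not> cmod (\<phi> x) \<le> norm x"
  then have nz: "\<phi> x \<noteq> 0" by auto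
  define b where "b = inverse (\<phi> x) *\<^sub>C x"
  have b1: "\<phi> b = 1" using nz by (simp add: b_def character_linear[OF assms])
  have nb: "norm b < 1" using * nz
    unfolding b_def norm_scaleC norm_inverse
    by (metis divide_inverse_commute divide_less_eq_1_pos not_le zero_less_norm_iff)
  have le: "norm (b ^ Suc n) \<le> norm b ^ Suc n" for n
  proof (induction n)
    case (Suc n)
    have "norm (b ^ Suc (Suc n)) \<le> norm b * norm (b ^ Suc n)"
      by (simp add: norm_mult_ineq)
    also have "\<dots> \<le> norm b * norm b ^ Suc n"
      by (intro mult_left_mono Suc) auto
    finally show ?case by simp
  qed simp
  have sg: "summable (\<lambda>n. norm b ^ Suc n)"
    using nb by (subst summable_Suc_iff) (simp add: summable_geometric)
  have "summable (\<lambda>n. b ^ Suc n)"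
    by (rule summable_comparison_test'[OF sg, of 0]) (rule le)
  then have s: "(\<lambda>n. b ^ Suc n) sums (\<Sum>n. b ^ Suc n)" by (rule summable_sums)
  define t where "t = (\<Sum>n. b ^ Suc n)"
  have "(\<lambda>n. b * b ^ Suc n) sums (b * t)"
    using s unfolding t_def by (rule bounded_linear.sums[OF bounded_linear_mult_right])
  then have "(\<lambda>n. b ^ Suc (Suc n)) sums (b * t)" by simp
  then have "(\<lambda>n. b ^ Suc n) sums (b * t + b)" by (subst (asm) sums_Suc_iff) simp
  then have "b * t + b = t" using s unfolding t_def by (rule sums_unique2)
  then have "\<phi> (b * t + b) = \<phi> t" by simp
  then have "\<phi> b * \<phi> t + \<phi> b = \<phi> t"
    using assms by (simp add: character_linear is_character_def)
  then show False using b1 by simp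
qed

lemma character_bounded_linear:
  assumes "is_character \<phi>"
  shows "bounded_linear (\<lambda>x. c * \<phi> x)"
proof (rule bounded_linear_intro[where K = "cmod c"])
  fix x y :: 'a and r :: real
  show "c * \<phi> (x + y) = c * \<phi> x + c * \<phi> y"
    by (simp add: character_linear[OF assms] algebra_simps)
  have "\<phi> (r *\<^sub>R x) = of_real r * \<phi> x"
    by (metis character_linear(2)[OF assms] scaleC_of_real)
  then show "c * \<phi> (r *\<^sub>R x) = r *\<^sub>R (c * \<phi> x)"
    by (simp add: scaleR_conv_of_real algebra_simps)
  show "norm (c * \<phi> x) \<le> norm x * cmod c"
    using character_norm_le[OF assms, of x]
    by (subst mult.commute) (simp add: norm_mult mult_right_mono)
qed

lemma blinfun_apply_scaled_character:
  assumes "is_character \<phi>"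
  shows "blinfun_apply (Blinfun (\<lambda>x. c * \<phi> x)) = (\<lambda>x. c * \<phi> x)"
  using character_bounded_linear[OF assms] by (rule bounded_linear_Blinfun_apply)

end

theory Submission
  imports Defs "HOL-Complex_Analysis.Conformal_Mappings"
begin

text \<open>
  Write \<open>K\<close> for the closure of the given sequence of characters. For \<open>f\<close> in the algebra, the points \<open>\<phi>\<^sub>n f\<close> lie in the
  compact plane set \<open>S = {\<psi> f | \<psi> \<in> K}\<close>. A perfect subset of \<open>S\<close> would lift to a perfect subset of
  \<open>K\<close>, namely to a minimal closed set mapping onto it; so \<open>S\<close> is countable
  (\<open>countable_image_of_scattered_compact\<close>).

  On a countable compact plane set, an absolutely summable combination of point masses is determined
  by its moments (\<open>atoms_zero_if_moments_zero\<close>). Its Cauchy transform vanishes near infinity, hence on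
  the complement of \<open>S\<close>, which is connected. All but countably many circles around a given point
  miss \<open>S\<close>, and integrating the Cauchy transform over such a circle shows that the disc carries no
  mass. Shrinking the disc leaves the mass of the point alone.

  Because characters are multiplicative, applying the relation \<open>\<Sum>n. \<lambda>\<^sub>n \<phi>\<^sub>n = 0\<close> to \<open>a * f ^ k\<close> says
  that the point masses \<open>\<lambda>\<^sub>n \<phi>\<^sub>n a\<close> at \<open>\<phi>\<^sub>n f\<close> have zero moments. So the relation survives restriction
  to the indices with \<open>\<phi>\<^sub>n f = \<phi>\<^sub>m f\<close>, and, by repetition, to the indices with \<open>\<phi>\<^sub>n = \<phi>\<^sub>m\<close> on a given
  finite set. A finite set distinguishes \<open>\<phi>\<^sub>m\<close> from any finitely many of the other characters, and
  the remaining ones contribute only a small tail of \<open>\<Sum>n. \<bar>\<lambda>\<^sub>n\<bar>\<close>; hence \<open>\<lambda>\<^sub>m = 0\<close>.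
\<close>

section \<open>Continuous images of scattered compact spaces\<close>

text \<open>
  The perfect part consists of the condensation points. The points of \<open>S\<close> that are not condensation
  points are covered by countably many basic open sets, each with countable trace on \<open>S\<close>; so every
  neighbourhood of a condensation point still contains uncountably many condensation points.
\<close>

lemma uncountable_closed_perfect_part:
  fixes S :: "'a::second_countable_topology set"
  assumes "closed S" "uncountable S"
  obtains P where "closed P" "P \<subseteq> S" "P \<noteq> {}" "\<forall>x\<in>P. x islimpt P"
proof -
  obtain B :: "'a set set" where B: "countable B" "topological_basis B"
    using ex_countable_basis by blast
  define V where "V = \<Union>{b \<in> B. countable (b \<inter> S)}"
  have open_V: "open V"
    unfolding V_def using B(2) by (auto intro: topological_basis_open)
  have "countable (\<Union>b\<in>{b \<in> B. countable (b \<inter> S)}. b \<inter> S)"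
    using B(1) by (intro countable_UN) auto
  moreover have "V \<inter> S = (\<Union>b\<in>{b \<in> B. countable (b \<inter> S)}. b \<inter> S)"
    unfolding V_def by blast
  ultimately have countable_V: "countable (V \<inter> S)"
    by (simp only:)
  show thesis
  proof
    show "closed (S - V)" using assms(1) open_V by (rule closed_Diff)
    show "S - V \<subseteq> S" by blast
    show "S - V \<noteq> {}"
      using countable_V assms(2) by (metis Diff_eq_empty_iff inf.absorb2)
    show "\<forall>x\<in>S - V. x islimpt (S - V)"
      unfolding islimpt_def
    proof (intro ballI allI impI)
      fix x T assume x: "x \<in> S - V" and T: "x \<in> T" "open T"
      then obtain b where b: "b \<in> B" "x \<in> b" "b \<subseteq> T"
        using topological_basisE[OF B(2)] by metis
      then have "uncountable (b \<inter> S)"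
        using x unfolding V_def by blast
      then have "uncountable (b \<inter> S - (insert x (V \<inter> S)))"
        using countable_V by (simp add: uncountable_minus_countable)
      then have "b \<inter> S - (insert x (V \<inter> S)) \<noteq> {}"
        by force
      then show "\<exists>y\<in>S - V. y \<in> T \<and> y \<noteq> x"
        using b(3) by blast
    qed
  qed
qed

text \<open>
  Zorn's lemma is applied to the open sets \<open>U\<close> such that \<open>K - U\<close> still maps onto \<open>P\<close>; compactness of
  the fibres shows that unions of chains keep this property. If \<open>q\<close> were isolated in a minimal
  \<open>K - U\<close>, then removing \<open>q\<close> would lose at most the value \<open>f q\<close>. But the image stays compact and
  \<open>f q\<close> is a limit of other points of \<open>P\<close>, so not even this value is lost.
\<close>

lemma perfect_set_lifts_along_compact_map:
  fixes f :: "'a::topological_space \<Rightarrow> 'b::t2_space"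
  assumes K: "compact K" "closed K" and f: "continuous_on K f"
    and P: "closed P" "P \<subseteq> f ` K" "P \<noteq> {}" "\<forall>x\<in>P. x islimpt P"
  obtains Q where "closed Q" "Q \<subseteq> K" "Q \<noteq> {}" "\<forall>x\<in>Q. x islimpt Q"
proof -
  \<comment> \<open>Complements turn the minimal closed set into a maximal open one, the form of Zorn's lemma used.\<close>
  define \<A> where "\<A> = {U. open U \<and> P \<subseteq> f ` (K - U)}"
  have "\<Union>C \<in> \<A>" if C: "subset.chain \<A> C" for C
  proof -
    have "p \<in> f ` (K - \<Union>C)" if p: "p \<in> P" for p
    proof (rule ccontr)
      assume neg: "p \<notin> f ` (K - \<Union>C)"
      have "closed (f -` {p} \<inter> K)"
        using f K(2) continuous_on_closed_vimage by blast
      then have "compact (f -` {p} \<inter> K)"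
        using K(1) by (metis compact_Int_closed inf_assoc inf_commute inf_idem)
      moreover have "f -` {p} \<inter> K \<subseteq> \<Union>C"
        using neg by blast
      moreover have "\<And>U. U \<in> C \<Longrightarrow> open U"
        using C by (auto simp: \<A>_def subset.chain_def)
      ultimately obtain D where D: "D \<subseteq> C" "finite D" "f -` {p} \<inter> K \<subseteq> \<Union>D"
        by (meson compactE)
      obtain x where x: "x \<in> f -` {p} \<inter> K"
        using p P(2) by blast
      then have "D \<noteq> {}" using D(3) by blast
      moreover have "subset.chain \<A> D"
        using C D(1) unfolding subset.chain_def by blast
      ultimately have "\<Union>D \<in> D"
        using D(2) Union_in_chain by blast
      then have "P \<subseteq> f ` (K - \<Union>D)"
        using D(1) C by (auto simp: \<A>_def subset.chain_def)
      then show False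
        using p D(3) by blast
    qed
    moreover have "open (\<Union>C)"
      using C by (auto simp: \<A>_def subset.chain_def)
    ultimately show ?thesis by (auto simp: \<A>_def)
  qed
  then obtain U where U: "U \<in> \<A>" and max: "\<And>V. V \<in> \<A> \<Longrightarrow> U \<subseteq> V \<Longrightarrow> V = U"
    using subset_Zorn'[of \<A>] by metis
  have open_U: "open U" and onto: "P \<subseteq> f ` (K - U)"
    using U by (auto simp: \<A>_def)
  show thesis
  proof
    show "closed (K - U)"
      using K(2) open_U by (rule closed_Diff)
    show "K - U \<subseteq> K" by blast
    show "K - U \<noteq> {}" using onto P(3) by blast
    show "\<forall>q\<in>K - U. q islimpt (K - U)"
    proof (intro ballI, rule ccontr)
      fix q assume q: "q \<in> K - U"
      assume "\<not> q islimpt (K - U)"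
      then obtain T where T: "open T" "q \<in> T" "T \<inter> (K - U) \<subseteq> {q}"
        unfolding islimpt_def by blast
      let ?I = "f ` (K - (U \<union> T))"
      have "compact (K - (U \<union> T))"
        using K T(1) open_U by (simp add: compact_diff open_Un)
      then have "closed ?I"
        using f by (metis Diff_subset compact_continuous_image compact_imp_closed continuous_on_subset)
      have most: "P - {f q} \<subseteq> ?I"
      proof
        fix p assume p: "p \<in> P - {f q}"
        then obtain x where "x \<in> K - U" "p = f x" using onto by blast
        then show "p \<in> ?I" using p T(3) by blast
      qed
      have "P \<subseteq> ?I"
      proof (cases "f q \<in> P")
        case True
        then have "f q islimpt (P - {f q})"
          using P(4) by (metis islimpt_insert insert_Diff)
        then have "f q \<in> ?I"
          using most \<open>closed ?I\<close> by (metis closed_limpt islimpt_subset)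
        then show ?thesis using most by blast
      qed (use most in blast)
      then have "U \<union> T \<in> \<A>"
        using open_U T(1) by (auto simp: \<A>_def)
      then have "U \<union> T = U" using max by blast
      then show False using q T(2) by blast
    qed
  qed
qed

lemma countable_image_of_scattered_compact:
  fixes f :: "'a::topological_space \<Rightarrow> 'b::{second_countable_topology, t2_space}"
  assumes K: "compact K" "closed K" and f: "continuous_on K f"
    and scattered: "\<And>Q. closed Q \<Longrightarrow> Q \<subseteq> K \<Longrightarrow> Q \<noteq> {} \<Longrightarrow> \<exists>x\<in>Q. \<not> x islimpt Q"
  shows "countable (f ` K)"
proof (rule ccontr)
  assume "uncountable (f ` K)"
  moreover have "closed (f ` K)"
    using K f by (simp add: compact_continuous_image compact_imp_closed)
  ultimately obtain P where "closed P" "P \<subseteq> f ` K" "P \<noteq> {}" "\<forall>x\<in>P. x islimpt P"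
    using uncountable_closed_perfect_part by metis
  then obtain Q where "closed Q" "Q \<subseteq> K" "Q \<noteq> {}" "\<forall>x\<in>Q. x islimpt Q"
    by (rule perfect_set_lifts_along_compact_map[OF K f])
  then show False
    using scattered by blast
qed

section \<open>Point masses on a countable compact plane set\<close>

text \<open>
  For an absolutely summable family, the index sets of zero sum are closed under pointwise
  convergence. This is the limit argument both for shrinking discs and for separating characters.
\<close>

lemma zero_sum_index_set_limit:
  fixes c :: "nat \<Rightarrow> complex"
  assumes c: "summable (\<lambda>n. norm (c n))"
    and approx: "\<And>N. \<exists>T. (\<lambda>n. if n \<in> T then c n else 0) sums 0 \<and> (\<forall>n<N. n \<in> T \<longleftrightarrow> n \<in> A)"
  shows "(\<lambda>n. if n \<in> A then c n else 0) sums 0"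
proof -
  let ?a = "\<lambda>n. if n \<in> A then c n else 0"
  have "summable ?a"
    by (rule summable_comparison_test'[OF c, of 0]) auto
  then have a: "?a sums suminf ?a"
    by (rule summable_sums)
  have "norm (suminf ?a) \<le> 0 + e" if e: "e > 0" for e
  proof -
    obtain N where N: "norm (\<Sum>n. norm (c (n + N))) < e"
      using suminf_exist_split[OF e c] by blast
    obtain T where T: "(\<lambda>n. if n \<in> T then c n else 0) sums 0" "\<And>n. n < N \<Longrightarrow> n \<in> T \<longleftrightarrow> n \<in> A"
      using approx by blast
    define d where "d n = ?a n - (if n \<in> T then c n else 0)" for n
    have "d sums (suminf ?a - 0)"
      unfolding d_def using a T(1) by (rule sums_diff)
    then have "(\<lambda>n. d (n + N)) sums (suminf ?a - (\<Sum>n<N. d n))"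
      by (simp add: sums_iff_shift)
    moreover have "(\<Sum>n<N. d n) = 0"
      using T(2) by (intro sum.neutral) (auto simp: d_def)
    ultimately have "suminf ?a = (\<Sum>n. d (n + N))"
      by (simp add: sums_unique)
    also have "norm \<dots> \<le> (\<Sum>n. norm (c (n + N)))"
      by (rule norm_suminf_le) (use summable_ignore_initial_segment[OF c, of N] in \<open>auto simp: d_def\<close>)
    finally show ?thesis using N by simp
  qed
  then have "norm (suminf ?a) \<le> 0"
    by (rule field_le_epsilon)
  then show ?thesis using a by simp
qed

lemma uniform_limit_Cauchy_transform:
  fixes c z :: "nat \<Rightarrow> complex"
  assumes "summable (\<lambda>n. norm (c n))" "0 < d" "\<And>w n. w \<in> A \<Longrightarrow> d \<le> norm (w - z n)"
  shows "uniform_limit A (\<lambda>N w. \<Sum>n<N. c n / (w - z n)) (\<lambda>w. \<Sum>n. c n / (w - z n)) sequentially"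
proof (rule Weierstrass_m_test)
  show "norm (c n / (w - z n)) \<le> norm (c n) / d" if "w \<in> A" for n w
    unfolding norm_divide using assms(2) assms(3)[OF that, of n] by (intro divide_left_mono mult_pos_pos) auto
  show "summable (\<lambda>n. norm (c n) / d)"
    using assms(1) by (rule summable_divide)
qed

lemma holomorphic_Cauchy_transform:
  fixes c z :: "nat \<Rightarrow> complex"
  assumes c: "summable (\<lambda>n. norm (c n))" and S: "closed S" "range z \<subseteq> S"
  shows "(\<lambda>w. \<Sum>n. c n / (w - z n)) holomorphic_on - S"
proof (rule holomorphic_uniform_sequence)
  show "open (- S)" using S(1) by blast
  show "(\<lambda>w. \<Sum>n<N. c n / (w - z n)) holomorphic_on - S" for N
    using S(2) by (intro holomorphic_intros) auto
  show "\<exists>d>0. cball x d \<subseteq> - S \<and> uniform_limit (cball x d) (\<lambda>N w. \<Sum>n<N. c n / (w - z n))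
      (\<lambda>w. \<Sum>n. c n / (w - z n)) sequentially" if x: "x \<in> - S" for x
  proof -
    obtain e where e: "e > 0" "cball x e \<subseteq> - S"
      using x S(1) open_contains_cball[of "- S"] by blast
    have "uniform_limit (cball x (e/2)) (\<lambda>N w. \<Sum>n<N. c n / (w - z n))
      (\<lambda>w. \<Sum>n. c n / (w - z n)) sequentially"
    proof (rule uniform_limit_Cauchy_transform[OF c])
      show "0 < e/2" using e by simp
      show "e/2 \<le> norm (w - z n)" if "w \<in> cball x (e/2)" for w n
      proof -
        have "z n \<notin> cball x e" using e(2) S(2) by blast
        then have "e < dist x (z n)" by simp
        also have "\<dots> \<le> dist x w + dist w (z n)" by (rule dist_triangle)
        finally show ?thesis using that by (simp add: dist_norm)
      qed
    qed
    moreover have "cball x (e/2) \<subseteq> - S"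
      using e(1) by (intro order_trans[OF subset_cball e(2)]) simp
    ultimately show ?thesis using e(1) half_gt_zero by blast
  qed
qed

text \<open>
  Subtracting the first \<open>k\<close> terms of the geometric expansion of \<open>1 / (w - z\<^sub>n)\<close> changes the sum by
  combinations of moments, that is, not at all. What remains is of order \<open>(R / \<bar>w\<bar>) ^ k\<close>.
\<close>

lemma Cauchy_transform_zero_near_infinity:
  fixes c z :: "nat \<Rightarrow> complex"
  assumes c: "summable (\<lambda>n. norm (c n))"
    and moments: "\<And>k. (\<lambda>n. c n * z n ^ k) sums 0"
    and R: "\<And>n. norm (z n) \<le> R" and w: "R < norm w"
  shows "(\<Sum>n. c n / (w - z n)) = 0"
proof -
  define G where "G = (\<Sum>n. c n / (w - z n))"
  define q where "q = R / norm w"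
  have "0 \<le> R" using R[of 0] norm_ge_zero order_trans by blast
  then have q: "0 \<le> q" "q < 1" and wpos: "0 < norm w" using w by (auto simp: q_def divide_less_eq)
  have far: "norm w - R \<le> norm (w - z n)" for n
    using norm_triangle_ineq2[of w "z n"] R[of n] by linarith
  then have nz: "w - z n \<noteq> 0" for n using w by (metis diff_gt_0_iff_gt norm_zero not_le)
  have bound: "norm (c n * (z n / w) ^ k / (w - z n)) \<le> norm (c n) * (q ^ k / (norm w - R))" for n k
  proof -
    have "norm (z n / w) \<le> q"
      unfolding q_def norm_divide using R wpos by (simp add: divide_right_mono)
    then have "norm (z n / w) ^ k \<le> q ^ k" by (simp add: power_mono)
    then have "norm (z n / w) ^ k / norm (w - z n) \<le> q ^ k / (norm w - R)"
      using far[of n] w q by (intro frac_le) auto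
    then have "norm (c n) * (norm (z n / w) ^ k / norm (w - z n)) \<le> norm (c n) * (q ^ k / (norm w - R))"
      by (rule mult_left_mono) simp
    then show ?thesis by (simp add: norm_mult norm_divide norm_power)
  qed
  have dominated: "summable (\<lambda>n. norm (c n) * (q ^ k / (norm w - R)))" for k
    using c by (rule summable_mult2)
  have remainder: "(\<lambda>n. c n * (z n / w) ^ k / (w - z n)) sums G" for k
  proof (induction k)
    case 0
    have "summable (\<lambda>n. c n / (w - z n))"
      using summable_comparison_test'[OF dominated[of 0], of 0 "\<lambda>n. c n / (w - z n)"] bound[of _ 0]
      by simp
    then show ?case by (simp add: G_def summable_sums)
  next
    case (Suc k)
    have "(\<lambda>n. c n * z n ^ k / w ^ Suc k) sums (0 / w ^ Suc k)"
      using moments by (rule sums_divide)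
    then have "(\<lambda>n. c n * (z n / w) ^ k / (w - z n) - c n * z n ^ k / w ^ Suc k) sums (G - 0)"
      using Suc by (intro sums_diff) simp_all
    moreover have "c n * (z n / w) ^ k / (w - z n) - c n * z n ^ k / w ^ Suc k
        = c n * (z n / w) ^ Suc k / (w - z n)" for n
      using nz[of n] wpos by (simp add: divide_simps power_divide) (simp add: algebra_simps)
    ultimately show ?case by simp
  qed
  have "norm G \<le> (\<Sum>n. norm (c n) * (q ^ k / (norm w - R)))" for k
    unfolding sums_unique[OF remainder[of k]] by (rule norm_suminf_le[OF bound dominated])
  then have "norm G \<le> (\<Sum>n. norm (c n)) * (q ^ k / (norm w - R))" for k
    using suminf_mult2[OF c] by metis
  moreover have "(\<lambda>k. (\<Sum>n. norm (c n)) * (q ^ k / (norm w - R))) \<longlonglongrightarrow> (\<Sum>n. norm (c n)) * (0 / (norm w - R))"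
    using q w by (intro tendsto_intros LIMSEQ_power_zero) auto
  ultimately have "norm G \<le> 0"
    using LIMSEQ_le_const[of _ 0 "norm G"] by auto
  then show ?thesis by (simp add: G_def)
qed

text \<open>
  Countability of \<open>S\<close> makes its complement connected, so the identity theorem carries the zeros near
  infinity to every point off \<open>S\<close>.
\<close>

lemma Cauchy_transform_zero_off_support:
  fixes c z :: "nat \<Rightarrow> complex"
  assumes c: "summable (\<lambda>n. norm (c n))"
    and moments: "\<And>k. (\<lambda>n. c n * z n ^ k) sums 0"
    and S: "compact S" "countable S" "range z \<subseteq> S" and w: "w \<notin> S"
  shows "(\<Sum>n. c n / (w - z n)) = 0"
proof -
  obtain R where R: "\<And>x. x \<in> S \<Longrightarrow> norm x \<le> R"
    using S(1) compact_imp_bounded bounded_iff by metis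
  define U where "U = - cball (0::complex) R"
  have U: "U \<subseteq> - S" using R by (auto simp: U_def)
  define \<xi> :: complex where "\<xi> = of_real (\<bar>R\<bar> + 1)"
  have \<xi>: "\<xi> \<in> U" by (simp add: U_def \<xi>_def del: of_real_add of_real_1)
  have "open U" by (simp add: U_def open_Compl)
  have zero_on_U: "(\<Sum>n. c n / (u - z n)) = 0" if "u \<in> U" for u
    using that R S(3)
    by (intro Cauchy_transform_zero_near_infinity[OF c moments, of R]) (auto simp: U_def)
  show ?thesis
  proof (rule analytic_continuation[where f = "\<lambda>w. \<Sum>n. c n / (w - z n)"])
    show "(\<lambda>w. \<Sum>n. c n / (w - z n)) holomorphic_on - S"
      using holomorphic_Cauchy_transform[OF c] S compact_imp_closed by blast
    show "open (- S)" using S(1) compact_imp_closed by blast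
    show "connected (- S)"
      unfolding Compl_eq_Diff_UNIV using S(2) by (intro connected_open_diff_countable) auto
    show "U \<subseteq> - S" "\<xi> \<in> - S" "w \<in> - S" using U \<xi> w by auto
    show "\<xi> islimpt U" using \<open>open U\<close> \<xi> by (simp add: interior_limit_point interior_open)
  qed (rule zero_on_U)
qed

text \<open>Integrated over a circle, the Cauchy transform counts the masses inside.\<close>

lemma disc_mass_zero:
  fixes c z :: "nat \<Rightarrow> complex"
  assumes c: "summable (\<lambda>n. norm (c n))" and S: "closed S" "range z \<subseteq> S"
    and zero: "\<And>w. w \<notin> S \<Longrightarrow> (\<Sum>n. c n / (w - z n)) = 0"
    and r: "0 < r" "sphere p r \<inter> S = {}"
  shows "(\<lambda>n. if dist p (z n) < r then c n else 0) sums 0"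
proof -
  let ?\<gamma> = "circlepath p r" and ?m = "\<lambda>n. if dist p (z n) < r then c n else 0"
  obtain d where d: "d > 0" "\<And>u x. u \<in> sphere p r \<Longrightarrow> x \<in> S \<Longrightarrow> d \<le> dist u x"
    using separate_compact_closed[OF compact_sphere S(1) r(2)] by blast
  have ul: "uniform_limit (sphere p r) (\<lambda>N w. \<Sum>n<N. c n / (w - z n))
      (\<lambda>w. \<Sum>n. c n / (w - z n)) sequentially"
  proof (rule uniform_limit_Cauchy_transform[OF c d(1)])
    show "d \<le> norm (w - z n)" if "w \<in> sphere p r" for w n
      using d(2)[OF that] S(2) by (metis dist_norm rangeI subsetD)
  qed
  have single: "((\<lambda>u. c n / (u - z n)) has_contour_integral 2 * of_real pi * \<i> * ?m n) ?\<gamma>" for n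
  proof (cases "dist p (z n) < r")
    case True
    then show ?thesis
      using Cauchy_integral_circlepath_simple[of "\<lambda>_. c n" p r "z n"]
      by (simp add: dist_norm norm_minus_commute)
  next
    case False
    moreover have "z n \<notin> sphere p r" using S(2) r(2) by blast
    ultimately have out: "r < dist p (z n)" by simp
    have "((\<lambda>u. c n / (u - z n)) has_contour_integral 0) ?\<gamma>"
    proof (rule Cauchy_theorem_disc_simple)
      show "(\<lambda>u. c n / (u - z n)) holomorphic_on ball p (dist p (z n))"
        by (intro holomorphic_intros) auto
      show "path_image ?\<gamma> \<subseteq> ball p (dist p (z n))"
        using r(1) out by auto
    qed auto
    then show ?thesis using False by simp
  qed
  have partial: "((\<lambda>u. \<Sum>n<N. c n / (u - z n)) has_contour_integral
      (\<Sum>n<N. 2 * of_real pi * \<i> * ?m n)) ?\<gamma>" for N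
    by (intro has_contour_integral_sum single) auto
  have "(\<lambda>N. contour_integral ?\<gamma> (\<lambda>u. \<Sum>n<N. c n / (u - z n)))
      \<longlonglongrightarrow> contour_integral ?\<gamma> (\<lambda>u. \<Sum>n. c n / (u - z n))"
    using partial by (intro contour_integral_uniform_limit_circlepath(2)[OF _ ul _ r(1)])
      (auto simp: contour_integrable_on_def intro!: always_eventually)
  moreover have "contour_integral ?\<gamma> (\<lambda>u. \<Sum>n. c n / (u - z n)) = contour_integral ?\<gamma> (\<lambda>u. 0)"
  proof (rule contour_integral_eq)
    show "(\<Sum>n. c n / (u - z n)) = 0" if "u \<in> path_image ?\<gamma>" for u
      using that r by (intro zero) auto
  qed
  ultimately have "(\<lambda>n. 2 * of_real pi * \<i> * ?m n) sums 0"
    unfolding sums_def by (simp only: contour_integral_unique[OF partial] contour_integral_0)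
  then have "(\<lambda>n. (2 * of_real pi * \<i> * ?m n) / (2 * of_real pi * \<i>)) sums (0 / (2 * of_real pi * \<i>))"
    by (rule sums_divide)
  then show ?thesis by simp
qed

text \<open>
  The radii are chosen from the uncountably many below any given bound: only countably many circles
  around \<open>p\<close> meet \<open>S\<close>.
\<close>

lemma atoms_zero_if_moments_zero:
  fixes c z :: "nat \<Rightarrow> complex"
  assumes c: "summable (\<lambda>n. norm (c n))"
    and moments: "\<And>k. (\<lambda>n. c n * z n ^ k) sums 0"
    and S: "compact S" "countable S" "range z \<subseteq> S"
  shows "(\<lambda>n. if z n = p then c n else 0) sums 0"
proof -
  have "\<exists>T. (\<lambda>n. if n \<in> T then c n else 0) sums 0 \<and> (\<forall>n<N. n \<in> T \<longleftrightarrow> n \<in> {n. z n = p})" for N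
  proof -
    \<comment> \<open>A disc of radius less than \<open>m\<close> contains none of the first \<open>N\<close> points except those equal to \<open>p\<close>;
      the \<open>1\<close> covers the case that all of them are.\<close>
    define m where "m = Min (insert 1 (dist p ` z ` {n. n < N \<and> z n \<noteq> p}))"
    have m: "0 < m" "\<And>n. n < N \<Longrightarrow> z n \<noteq> p \<Longrightarrow> m \<le> dist p (z n)"
      by (auto simp: m_def)
    have "uncountable {0<..<m}" using m(1) by (simp add: uncountable_open_interval)
    then have "uncountable ({0<..<m} - dist p ` S)"
      using S(2) by (simp add: uncountable_minus_countable)
    then have "{0<..<m} - dist p ` S \<noteq> {}" by force
    then obtain r where r: "0 < r" "r < m" "r \<notin> dist p ` S"
      by (metis Diff_iff ex_in_conv greaterThanLessThan_iff)
    then have "sphere p r \<inter> S = {}" by auto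
    then have "(\<lambda>n. if dist p (z n) < r then c n else 0) sums 0"
      using disc_mass_zero[OF c compact_imp_closed[OF S(1)] S(3) _ r(1)]
        Cauchy_transform_zero_off_support[OF c moments S] by blast
    moreover have "\<forall>n<N. dist p (z n) < r \<longleftrightarrow> z n = p"
      using m(2) r by force
    ultimately show ?thesis
      by (intro exI[of _ "{n. dist p (z n) < r}"]) simp
  qed
  from zero_sum_index_set_limit[OF c this] show ?thesis by simp
qed

section \<open>Characters\<close>

lemma character_mult: "is_character \<phi> \<Longrightarrow> \<phi> (x * y) = \<phi> x * \<phi> y"
  by (simp add: is_character_def)

lemma character_one:
  assumes "is_character \<phi>"
  shows "\<phi> 1 = 1"
proof -
  obtain x where "\<phi> x \<noteq> 0" using assms by (auto simp: is_character_def)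
  then show ?thesis using character_mult[OF assms, of x 1] by simp
qed

lemma character_power: "is_character \<phi> \<Longrightarrow> \<phi> (x ^ k) = \<phi> x ^ k"
  by (induction k) (simp_all add: character_one character_mult)

text \<open>
  The condition \<open>\<exists>x. \<phi> x \<noteq> 0\<close> is not closed under pointwise limits as it stands; replacing it by
  \<open>\<phi> 1 = 1\<close> leaves only equations between finitely many values of \<open>\<phi>\<close>.
\<close>

lemma is_character_iff:
  "is_character \<phi> \<longleftrightarrow> \<phi> 1 = 1 \<and> (\<forall>x y. \<phi> (x + y) = \<phi> x + \<phi> y) \<and>
    (\<forall>c x. \<phi> (c *\<^sub>C x) = c * \<phi> x) \<and> (\<forall>x y. \<phi> (x * y) = \<phi> x * \<phi> y)"
proof
  assume "is_character \<phi>"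
  then show "\<phi> 1 = 1 \<and> (\<forall>x y. \<phi> (x + y) = \<phi> x + \<phi> y) \<and>
    (\<forall>c x. \<phi> (c *\<^sub>C x) = c * \<phi> x) \<and> (\<forall>x y. \<phi> (x * y) = \<phi> x * \<phi> y)"
    by (simp add: character_one character_linear character_mult)
next
  assume *: "\<phi> 1 = 1 \<and> (\<forall>x y. \<phi> (x + y) = \<phi> x + \<phi> y) \<and>
    (\<forall>c x. \<phi> (c *\<^sub>C x) = c * \<phi> x) \<and> (\<forall>x y. \<phi> (x * y) = \<phi> x * \<phi> y)"
  have "vector_space ((*) :: complex \<Rightarrow> complex \<Rightarrow> complex)"
    by unfold_locales (simp_all add: algebra_simps)
  then have "Vector_Spaces.linear scaleC (*) \<phi>"
    using * by (simp add: Vector_Spaces.linear_iff vector_space_scaleC)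
  moreover have "\<phi> 1 \<noteq> 0" using * by simp
  ultimately show "is_character \<phi>"
    using * unfolding is_character_def by blast
qed

lemma closed_characters: "closed {\<phi>. is_character \<phi>}"
  unfolding is_character_iff
  by (intro closed_Collect_conj closed_Collect_all closed_Collect_eq continuous_intros
      continuous_on_product_coordinates)

lemma compact_characters:
  "compact {\<phi> :: 'a::comm_unital_complex_banach_algebra \<Rightarrow> complex. is_character \<phi>}"
proof -
  let ?B = "PiE UNIV (\<lambda>x::'a. cball (0::complex) (norm x))"
  have "compactin (product_topology (\<lambda>_::'a. euclidean) UNIV) ?B"
    by (simp add: compactin_PiE)
  then have "compact ?B"
    by (simp add: euclidean_product_topology)
  then have "compact (?B \<inter> {\<phi>. is_character \<phi>})"
    using closed_characters by (rule compact_Int_closed)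
  moreover have "{\<phi>. is_character \<phi>} \<subseteq> ?B"
    by (auto simp: character_norm_le)
  ultimately show ?thesis by (simp add: inf.absorb2)
qed

lemma character_space_eq_top_of_set: "character_space = top_of_set {\<phi>. is_character \<phi>}"
  by (simp add: character_space_def euclidean_product_topology)

text \<open>
  Masses \<open>l n\<close> annihilating the algebra annihilate it also after restriction to the indices where
  \<open>\<phi> n\<close> takes the value \<open>p\<close> at \<open>f\<close>: weighting by \<open>\<phi> n a\<close> turns the values at \<open>a * f ^ k\<close> into moments.
\<close>

lemma annihilating_masses_restrict:
  fixes \<phi> :: "nat \<Rightarrow> 'a::comm_unital_complex_banach_algebra \<Rightarrow> complex"
  assumes chars: "\<And>n. is_character (\<phi> n)"
    and l: "summable (\<lambda>n. norm (l n))" "\<And>a. (\<lambda>n. l n * \<phi> n a) sums 0"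
    and S: "compact S" "countable S" "range (\<lambda>n. \<phi> n f) \<subseteq> S"
  shows "(\<lambda>n. (if \<phi> n f = p then l n else 0) * \<phi> n a) sums 0"
proof -
  have "(\<lambda>n. if \<phi> n f = p then l n * \<phi> n a else 0) sums 0"
  proof (rule atoms_zero_if_moments_zero[OF _ _ S])
    show "summable (\<lambda>n. norm (l n * \<phi> n a))"
    proof (rule summable_comparison_test'[of _ 0])
      show "summable (\<lambda>n. norm (l n) * norm a)" using l(1) by (rule summable_mult2)
      show "norm (norm (l n * \<phi> n a)) \<le> norm (l n) * norm a" for n
        using character_norm_le[OF chars] by (simp add: norm_mult mult_left_mono)
    qed
    show "(\<lambda>n. l n * \<phi> n a * \<phi> n f ^ k) sums 0" for k
      using l(2)[of "a * f ^ k"] by (simp add: chars character_mult character_power mult.assoc)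
  qed
  then show ?thesis by (simp add: if_distrib if_distribR cong: if_cong)
qed

section \<open>Independence of characters with scattered closure\<close>

theorem theorem9:
  fixes \<phi> :: "nat \<Rightarrow> 'a::comm_unital_complex_banach_algebra \<Rightarrow> complex"
    and l :: "nat \<Rightarrow> complex"
  assumes "\<And>n. is_character (\<phi> n)"
    and "inj \<phi>"
    and "\<not> (\<exists>P. perfect_subset (subtopology character_space (character_space closure_of range \<phi>)) P)"
    and "summable (\<lambda>n. cmod (l n))"
    and "(\<lambda>n. Blinfun (\<lambda>x. l n * \<phi> n x)) sums 0"
  shows "\<forall>n. l n = 0"
proof
  fix m
  define K where "K = closure (range \<phi>)"
  have K: "K \<subseteq> {\<psi>. is_character \<psi>}"
    unfolding K_def using assms(1) closed_characters by (intro closure_minimal) auto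
  then have "compact K"
    using compact_Int_closed[OF compact_characters, of K] by (simp add: K_def inf.absorb2)
  have "character_space closure_of range \<phi> = K"
    using K assms(1) unfolding character_space_eq_top_of_set K_def
    by (simp add: closure_of_subtopology closure_of_subset_Int inf.absorb2 image_subset_iff)
  then have K_top: "subtopology character_space (character_space closure_of range \<phi>) = top_of_set K"
    using K by (simp add: character_space_eq_top_of_set subtopology_subtopology inf.absorb2)
  have scattered: "\<exists>x\<in>Q. \<not> x islimpt Q" if Q: "closed Q" "Q \<subseteq> K" "Q \<noteq> {}" for Q
  proof (rule ccontr)
    assume "\<not> (\<exists>x\<in>Q. \<not> x islimpt Q)"
    then have "\<not> openin (top_of_set Q) {x}" if "x \<in> Q" for x
      using that unfolding openin_open islimpt_def by (metis IntE IntI insertCI singletonD)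
    moreover have "closedin (top_of_set K) Q"
      using Q by (simp add: closed_subset)
    moreover have "subtopology (top_of_set K) Q = top_of_set Q"
      using Q(2) by (simp add: subtopology_subtopology inf.absorb2)
    ultimately have "perfect_subset (top_of_set K) Q"
      using Q(3) by (simp add: perfect_subset_def)
    then show False using assms(3) K_top by auto
  qed
  have countable_values: "countable ((\<lambda>\<psi>. \<psi> f) ` K)" and compact_values: "compact ((\<lambda>\<psi>. \<psi> f) ` K)" for f
  proof -
    have cont: "continuous_on K (\<lambda>\<psi>. \<psi> f)"
      by (rule continuous_on_subset[OF continuous_on_product_coordinates subset_UNIV])
    show "countable ((\<lambda>\<psi>. \<psi> f) ` K)"
      by (rule countable_image_of_scattered_compact[OF \<open>compact K\<close> _ cont scattered])
        (simp add: K_def)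
    show "compact ((\<lambda>\<psi>. \<psi> f) ` K)"
      by (rule compact_continuous_image[OF cont \<open>compact K\<close>])
  qed
  have annihilates: "(\<lambda>n. l n * \<phi> n a) sums 0" for a
    using bounded_linear.sums[OF blinfun.bounded_linear_left assms(5), of a]
    by (simp add: blinfun_apply_scaled_character[OF assms(1)])
  have agree: "(\<lambda>n. (if \<forall>f\<in>F. \<phi> n f = \<phi> m f then l n else 0) * \<phi> n a) sums 0" if "finite F" for F a
    using that
  proof (induction F arbitrary: a)
    case empty
    then show ?case using annihilates by simp
  next
    case (insert f F)
    let ?l = "\<lambda>n. if \<forall>f\<in>F. \<phi> n f = \<phi> m f then l n else 0"
    have "summable (\<lambda>n. norm (?l n))"
      by (rule summable_comparison_test'[OF assms(4), of 0]) auto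
    moreover have "range (\<lambda>n. \<phi> n f) \<subseteq> (\<lambda>\<psi>. \<psi> f) ` K"
      unfolding K_def using closure_subset[of "range \<phi>"] by blast
    ultimately have "(\<lambda>n. (if \<phi> n f = \<phi> m f then ?l n else 0) * \<phi> n a) sums 0"
      using insert.IH compact_values countable_values
      by (intro annihilating_masses_restrict[OF assms(1)])
    moreover have "(if \<phi> n f = \<phi> m f then ?l n else 0)
        = (if \<forall>f\<in>insert f F. \<phi> n f = \<phi> m f then l n else 0)" for n
      by simp
    ultimately show ?case by (simp only:)
  qed
  have "\<exists>T. (\<lambda>n. if n \<in> T then l n else 0) sums 0 \<and> (\<forall>n<N. n \<in> T \<longleftrightarrow> n \<in> {m})" for N
  proof -
    obtain s where s: "\<And>n. n \<noteq> m \<Longrightarrow> \<phi> n (s n) \<noteq> \<phi> m (s n)"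
      using assms(2) unfolding inj_def fun_eq_iff by metis
    define F where "F = s ` {..<N}"
    have "(\<lambda>n. if n \<in> {n. \<forall>f\<in>F. \<phi> n f = \<phi> m f} then l n else 0) sums 0"
      using agree[of F 1] by (simp add: F_def character_one[OF assms(1)])
    moreover have "\<forall>n<N. n \<in> {n. \<forall>f\<in>F. \<phi> n f = \<phi> m f} \<longleftrightarrow> n \<in> {m}"
      using s by (auto simp: F_def)
    ultimately show ?thesis by blast
  qed
  from zero_sum_index_set_limit[OF assms(4) this]
  have "(\<lambda>n. if n = m then l n else 0) sums 0" by simp
  then show "l m = 0"
    using sums_single[of m l] sums_unique2 by blast
qed

end
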